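(* Let $M\subset\mathbb{R}^d$ be a non-empty compact set, let $l>0$, and let $\lambda>1$ be any constant. Then the problem $$\min\left\{F_M(\Sigma)+\lambda\,(\mathcal{H}^1(\Sigma)-l)^{+} \;:\; \Sigma\subset\mathbb{R}^d \text{ compact and connected}\right\}$$ is equivalent to the maximal distance minimization problem $$\min\left\{F_M(\Sigma)\;:\;\Sigma\subset\mathbb{R}^d\text{ compact and connected},\ \mathcal{H}^1(\Sigma)\le l\right\},$$ that is, the two problems have the same set of minimizers.
   Context: $\mathcal{H}^1$ denotes one-dimensional Hausdorff measure, $t^{+}:=\max(t,0)$, and $F_M(\Sigma):=\max_{y\in M}\mathrm{dist}(y,\Sigma)$ with $\mathrm{dist}$ the Euclidean distance; by convention $F_M(\emptyset):=\infty$. *)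

theory Defs
  imports "HOL-Analysis.Analysis"
begin

text \<open>
  One-dimensional Hausdorff (outer) measure on arbitrary subsets of a metric space. No
  normalising factor appears, since in dimension one it equals \<open>1\<close>. Covers are sequences; finite
  covers are included because members may be empty. Boundedness of the members is required
  explicitly because \<^const>\<open>diameter\<close> is real-valued and meaningless on unbounded sets.
\<close>

definition hausdorff1_pre :: "real \<Rightarrow> 'a::metric_space set \<Rightarrow> ennreal" where
  "hausdorff1_pre \<delta> S =
     (INF U \<in> {U :: nat \<Rightarrow> 'a set. S \<subseteq> (\<Union>i. U i) \<and> (\<forall>i. bounded (U i) \<and> diameter (U i) \<le> \<delta>)}.
        \<Sum>i. ennreal (diameter (U i)))"

definition hausdorff1 :: "'a::metric_space set \<Rightarrow> ennreal" where
  "hausdorff1 S = (SUP \<delta> \<in> {0<..}. hausdorff1_pre \<delta> S)"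

text \<open>
  The supremum is attained for \<open>M\<close> compact and non-empty (lemma \<open>max_dist_attained\<close>). The empty set needs a
  separate case because \<open>infdist y {} = 0\<close>.
\<close>

definition max_dist :: "'a::metric_space set \<Rightarrow> 'a set \<Rightarrow> ereal" where
  "max_dist M \<Sigma> = (if \<Sigma> = {} then \<infinity> else (SUP y\<in>M. ereal (infdist y \<Sigma>)))"

lemma max_dist_attained:
  assumes "compact M" "M \<noteq> {}" "\<Sigma> \<noteq> {}"
  shows "\<exists>y\<in>M. max_dist M \<Sigma> = ereal (infdist y \<Sigma>) \<and> (\<forall>z\<in>M. infdist z \<Sigma> \<le> infdist y \<Sigma>)"
proof -
  have "continuous_on M (\<lambda>z. infdist z \<Sigma>)"
    by (intro continuous_on_infdist continuous_on_id)
  from continuous_attains_sup[OF assms(1,2) this]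
  obtain y where y: "y \<in> M" "\<forall>z\<in>M. infdist z \<Sigma> \<le> infdist y \<Sigma>"
    by blast
  have "(SUP z\<in>M. ereal (infdist z \<Sigma>)) = ereal (infdist y \<Sigma>)"
  proof (rule antisym)
    show "(SUP z\<in>M. ereal (infdist z \<Sigma>)) \<le> ereal (infdist y \<Sigma>)"
      by (rule SUP_least) (use y(2) in simp)
    show "ereal (infdist y \<Sigma>) \<le> (SUP z\<in>M. ereal (infdist z \<Sigma>))"
      using y(1) by (rule SUP_upper)
  qed
  with y assms(3) show ?thesis by (auto simp: max_dist_def)
qed

end

theory Submission
  imports Defs
begin

text \<open>
  If \<open>\<Sigma>\<close> is connected and \<open>L = \<H>\<^sup>1(\<Sigma>)\<close> is finite with \<open>L > l\<close>, shrink \<open>\<Sigma>\<close> by the factor \<open>l / L\<close>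
  towards one of its points. The shrunk set has length at most \<open>l\<close>, and since a connected set has
  diameter at most \<open>L\<close>, every point moved by at most \<open>(1 - l / L) L = L - l\<close>. Hence \<open>F\<^sub>M\<close> grew by at most
  \<open>L - l\<close>, which is less than the penalty \<open>\<lambda> (L - l)\<close>.
\<close>

lemma hausdorff1_pre_le:
  assumes "S \<subseteq> (\<Union>i. U i)" "\<And>i. bounded (U i)" "\<And>i. diameter (U i) \<le> \<delta>"
  shows "hausdorff1_pre \<delta> S \<le> (\<Sum>i. ennreal (diameter (U i)))"
  unfolding hausdorff1_pre_def by (rule INF_lower) (use assms in auto)

text \<open>A cover of \<open>S\<close> is pushed forward by \<open>f\<close>, and each member's
  diameter grows by at most the factor \<open>K\<close>. The admissible scale must therefore grow
  from \<open>\<delta>\<close> to \<open>K * \<delta>\<close> as well.\<close>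

lemma hausdorff1_pre_lipschitz_image:
  fixes f :: "'a::metric_space \<Rightarrow> 'b::metric_space"
  assumes f: "K-lipschitz_on S f" and "K > 0"
  shows "hausdorff1_pre (K * \<delta>) (f ` S) \<le> ennreal K * hausdorff1_pre \<delta> S"
proof -
  \<comment> \<open>Dividing by \<open>K\<close> isolates the infimum on the right, so it suffices
    to test a single cover. The factor is multiplied back at the end, which is legitimate since
    \<open>ennreal K\<close> is neither zero nor infinite.\<close>
  have "hausdorff1_pre (K * \<delta>) (f ` S) / ennreal K \<le> hausdorff1_pre \<delta> S"
    unfolding hausdorff1_pre_def[of \<delta>]
  proof (rule INF_greatest)
    fix U :: "nat \<Rightarrow> 'a set"
    assume "U \<in> {U. S \<subseteq> (\<Union>i. U i) \<and> (\<forall>i. bounded (U i) \<and> diameter (U i) \<le> \<delta>)}"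
    then have cov: "S \<subseteq> (\<Union>i. U i)"
      and bdd: "\<And>i. bounded (U i)" and diam: "\<And>i. diameter (U i) \<le> \<delta>" by auto
    \<comment> \<open>Members of the cover may stick out of \<open>S\<close>, where \<open>f\<close>
      satisfies no Lipschitz bound; hence the intersection.\<close>
    define V where "V i = f ` (U i \<inter> S)" for i
    have dist_V: "dist x y \<le> K * diameter (U i)" if xy: "x \<in> V i" "y \<in> V i" for x y i
    proof -
      obtain a b where ab: "a \<in> U i \<inter> S" "b \<in> U i \<inter> S" "x = f a" "y = f b"
        using xy by (auto simp: V_def)
      have "dist x y \<le> K * dist a b" using lipschitz_onD[OF f] ab by auto
      also have "\<dots> \<le> K * diameter (U i)"
        using diameter_bounded_bound[OF bdd[of i], of a b] ab \<open>K > 0\<close> by auto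
      finally show ?thesis .
    qed
    have bdd_V: "bounded (V i)" for i
      unfolding bounded_two_points using dist_V by blast
    \<comment> \<open>The empty set is split off because its diameter is 0 by convention and not
      given by the supremum.\<close>
    have diam_V: "diameter (V i) \<le> K * diameter (U i)" for i
    proof (cases "V i = {}")
      case True
      then show ?thesis using diameter_ge_0[OF bdd[of i]] \<open>K > 0\<close> by simp
    next
      case False
      then show ?thesis unfolding diameter_def[of "V i"] using dist_V[of _ i]
        by (auto intro!: cSUP_least)
    qed
    have "hausdorff1_pre (K * \<delta>) (f ` S) \<le> (\<Sum>i. ennreal (diameter (V i)))"
    proof (rule hausdorff1_pre_le)
      show "f ` S \<subseteq> (\<Union>i. V i)" using cov unfolding V_def by blast
      show "diameter (V i) \<le> K * \<delta>" for i
        using diam_V[of i] diam[of i] \<open>K > 0\<close> by (meson mult_left_mono less_imp_le order_trans)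
    qed (rule bdd_V)
    also have "\<dots> \<le> (\<Sum>i. ennreal K * ennreal (diameter (U i)))"
      using \<open>K > 0\<close> diameter_ge_0[OF bdd] diam_V
      by (intro suminf_le) (auto simp: ennreal_mult[symmetric] intro!: ennreal_leI)
    finally have "hausdorff1_pre (K * \<delta>) (f ` S) \<le> ennreal K * (\<Sum>i. ennreal (diameter (U i)))"
      by simp
    then show "hausdorff1_pre (K * \<delta>) (f ` S) / ennreal K \<le> (\<Sum>i. ennreal (diameter (U i)))"
      using \<open>K > 0\<close> by (intro divide_le_posI_ennreal) (auto simp: mult.commute)
  qed
  then have "hausdorff1_pre (K * \<delta>) (f ` S) / ennreal K * ennreal K
      \<le> hausdorff1_pre \<delta> S * ennreal K"
    by (rule mult_right_mono) simp
  then show ?thesis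
    using \<open>K > 0\<close> by (simp add: ennreal_divide_times) (simp add: mult.commute)
qed

lemma hausdorff1_lipschitz_image:
  fixes f :: "'a::metric_space \<Rightarrow> 'b::metric_space"
  assumes "K-lipschitz_on S f" and "K > 0"
  shows "hausdorff1 (f ` S) \<le> ennreal K * hausdorff1 S"
  unfolding hausdorff1_def[of "f ` S"]
proof (rule SUP_least)
  fix \<delta> :: real assume "\<delta> \<in> {0<..}"
  \<comment> \<open>Covers of \<open>S\<close> at scale \<open>\<delta> / K\<close> are pushed to
    covers of the image at scale \<open>\<delta>\<close>.\<close>
  then have "hausdorff1_pre (\<delta> / K) S \<le> hausdorff1 S"
    unfolding hausdorff1_def using \<open>K > 0\<close> by (intro SUP_upper) auto
  moreover have "hausdorff1_pre \<delta> (f ` S) \<le> ennreal K * hausdorff1_pre (\<delta> / K) S"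
    using hausdorff1_pre_lipschitz_image[OF assms, of "\<delta> / K"] \<open>K > 0\<close> by simp
  ultimately show "hausdorff1_pre \<delta> (f ` S) \<le> ennreal K * hausdorff1 S"
    by (meson mult_left_mono order_trans zero_le)
qed

lemma hausdorff1_subset_singleton:
  assumes "S \<subseteq> {x}"
  shows "hausdorff1 S = 0"
proof -
  have "hausdorff1_pre \<delta> S \<le> 0" if "\<delta> > 0" for \<delta>
    using hausdorff1_pre_le[of S "\<lambda>_. {x}" \<delta>] assms that by simp
  then show ?thesis unfolding hausdorff1_def by (intro antisym SUP_least) auto
qed

text \<open>The 1-Lipschitz function \<open>dist x\<close> maps \<open>S\<close> to the real line.
  By connectedness the image contains the whole interval from 0 to \<open>dist x y\<close>, and
  countable subadditivity of Lebesgue measure bounds its length by the sum of the diameters of any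
  cover.\<close>

lemma dist_le_hausdorff1:
  fixes S :: "'a::metric_space set"
  assumes "connected S" "x \<in> S" "y \<in> S"
  shows "ennreal (dist x y) \<le> hausdorff1 S"
proof -
  \<comment> \<open>The scale 1 is an arbitrary choice: the bound holds for every cover by bounded
    sets, and \<open>hausdorff1\<close> dominates the value at each positive scale.\<close>
  have "ennreal (dist x y) \<le> hausdorff1_pre 1 S"
    unfolding hausdorff1_pre_def
  proof (rule INF_greatest)
    fix U :: "nat \<Rightarrow> 'a set"
    assume "U \<in> {U. S \<subseteq> (\<Union>i. U i) \<and> (\<forall>i. bounded (U i) \<and> diameter (U i) \<le> 1)}"
    then have cov: "S \<subseteq> (\<Union>i. U i)" and bdd: "\<And>i. bounded (U i)" by auto
    have conn: "connected (dist x ` S)"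
      using assms(1) by (intro connected_continuous_image continuous_intros)
    have sub: "{0..dist x y} \<subseteq> dist x ` S"
      using connected_contains_Icc[OF conn, of 0 "dist x y"] assms by force
    \<comment> \<open>The interval starts at the infimum of the image, so its length need not exceed
      the diameter of \<open>U i\<close>. For empty \<open>U i\<close> any \<open>a\<close> will
      do.\<close>
    have "\<exists>a. dist x ` U i \<subseteq> {a..a + diameter (U i)}" for i
    proof (cases "U i = {}")
      case False
      define a where "a = Inf (dist x ` U i)"
      have "a \<le> dist x z" if "z \<in> U i" for z
        unfolding a_def by (rule cInf_lower) (use that in \<open>auto intro!: bdd_belowI[of _ 0]\<close>)
      moreover have "dist x z \<le> a + diameter (U i)" if z: "z \<in> U i" for z
      proof -
        have "dist x z - diameter (U i) \<le> dist x w" if "w \<in> U i" for w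
          using diameter_bounded_bound[OF bdd[of i] that z] dist_triangle[of x z w] by simp
        then have "dist x z - diameter (U i) \<le> a"
          unfolding a_def using False by (intro cInf_greatest) auto
        then show ?thesis by simp
      qed
      ultimately have "dist x ` U i \<subseteq> {a..a + diameter (U i)}" by auto
      then show ?thesis ..
    qed auto
    then obtain a where a: "\<And>i. dist x ` U i \<subseteq> {a i..a i + diameter (U i)}" by metis
    have "ennreal (dist x y) = emeasure lborel {0..dist x y}" by simp
    also have "\<dots> \<le> emeasure lborel (\<Union>i. {a i..a i + diameter (U i)})"
      using sub cov a by (intro emeasure_mono) (force, simp)
    also have "\<dots> \<le> (\<Sum>i. emeasure lborel {a i..a i + diameter (U i)})"
      by (rule emeasure_subadditive_countably) auto
    also have "\<dots> = (\<Sum>i. ennreal (diameter (U i)))"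
      using diameter_ge_0[OF bdd] by simp
    finally show "ennreal (dist x y) \<le> (\<Sum>i. ennreal (diameter (U i)))" .
  qed
  also have "\<dots> \<le> hausdorff1 S"
    unfolding hausdorff1_def by (rule SUP_upper) auto
  finally show ?thesis .
qed

lemma max_dist_eq_ereal:
  assumes "compact M" "M \<noteq> {}" "\<Sigma> \<noteq> {}"
  obtains r where "max_dist M \<Sigma> = ereal r" "r \<ge> 0"
  using max_dist_attained[OF assms] infdist_nonneg by metis

lemma max_dist_nonneg:
  assumes "M \<noteq> {}"
  shows "max_dist M \<Sigma> \<ge> 0"
  using assms by (auto simp: max_dist_def infdist_nonneg intro: SUP_upper2)

text \<open>A point \<open>y\<close> of \<open>M\<close> has a nearest point \<open>p\<close> in the
  compact set \<open>S\<close>; the moved point \<open>f p\<close> is at most \<open>c\<close>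
  further away from \<open>y\<close>.\<close>

lemma max_dist_image_le:
  fixes S :: "'a::heine_borel set"
  assumes "compact S" and ne: "S \<noteq> {}" and f: "\<And>x. x \<in> S \<Longrightarrow> dist x (f x) \<le> c"
  shows "max_dist M (f ` S) \<le> max_dist M S + ereal c"
proof -
  have "ereal (infdist y (f ` S)) \<le> max_dist M S + ereal c" if "y \<in> M" for y
  proof -
    obtain p where p: "p \<in> S" "infdist y S = dist y p"
      using infdist_attains_inf[OF compact_imp_closed[OF \<open>compact S\<close>] ne] by metis
    have "infdist y (f ` S) \<le> dist y (f p)" using p by (intro infdist_le) auto
    also have "\<dots> \<le> infdist y S + c"
      using dist_triangle[of y "f p" p] f[OF p(1)] p(2) by simp
    finally have "ereal (infdist y (f ` S)) \<le> ereal (infdist y S) + ereal c" by simp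
    also have "\<dots> \<le> max_dist M S + ereal c"
    proof (rule add_right_mono)
      show "ereal (infdist y S) \<le> max_dist M S"
        unfolding max_dist_def using ne that by (auto intro: SUP_upper)
    qed
    finally show ?thesis .
  qed
  then show ?thesis using ne by (auto simp: max_dist_def[of M "f ` S"] intro: SUP_least)
qed

lemma shrink_to_length:
  fixes \<Sigma> :: "'a::{real_normed_vector, heine_borel} set"
  assumes \<Sigma>: "compact \<Sigma>" "connected \<Sigma>" "\<Sigma> \<noteq> {}"
    and L: "hausdorff1 \<Sigma> = ennreal L" and l: "0 < l" "l \<le> L"
  obtains \<Sigma>' where "compact \<Sigma>'" "connected \<Sigma>'" "hausdorff1 \<Sigma>' \<le> ennreal l"
    "max_dist M \<Sigma>' \<le> max_dist M \<Sigma> + ereal (L - l)"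
proof -
  obtain x0 where x0: "x0 \<in> \<Sigma>" using \<Sigma>(3) by auto
  define t where "t = l / L"
  have t: "0 < t" "t \<le> 1" "t * L = l" using l by (auto simp: t_def)
  define f where "f x = x0 + t *\<^sub>R (x - x0)" for x
  have lip: "t-lipschitz_on \<Sigma> f"
    using t(1) by (intro lipschitz_onI)
      (auto simp: f_def dist_norm scaleR_diff_right[symmetric] simp del: scaleR_diff_right)
  have cont: "continuous_on \<Sigma> f" using lip by (rule lipschitz_on_continuous_on)
  have "hausdorff1 (f ` \<Sigma>) \<le> ennreal t * ennreal L"
    using hausdorff1_lipschitz_image[OF lip t(1)] by (simp add: L)
  then have len: "hausdorff1 (f ` \<Sigma>) \<le> ennreal l"
    using t l by (simp add: ennreal_mult[symmetric])
  have moved: "dist x (f x) \<le> L - l" if "x \<in> \<Sigma>" for x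
  proof -
    \<comment> \<open>The centre \<open>x0\<close> was taken inside \<open>\<Sigma>\<close> so that
      the bound for connected sets applies to the pair \<open>x\<close>, \<open>x0\<close>.\<close>
    have "dist x x0 \<le> L" using dist_le_hausdorff1[OF \<Sigma>(2) that x0] l by (simp add: L)
    have "x - f x = (1 - t) *\<^sub>R (x - x0)" by (simp add: f_def algebra_simps)
    then have "dist x (f x) = (1 - t) * dist x x0" using t(2) by (simp add: dist_norm)
    also have "\<dots> \<le> (1 - t) * L" using \<open>dist x x0 \<le> L\<close> t(2) by (intro mult_left_mono) auto
    finally show ?thesis using t(3) by (simp add: algebra_simps)
  qed
  show ?thesis
    using that[of "f ` \<Sigma>"] compact_continuous_image[OF cont \<Sigma>(1)]
      connected_continuous_image[OF cont \<Sigma>(2)] len max_dist_image_le[OF \<Sigma>(1,3) moved] by blast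
qed

theorem proposition5p5:
  fixes M :: "(real ^ 'd) set" and l lam :: real
  assumes "compact M" and "M \<noteq> {}" and "l > 0" and "lam > 1"
  shows "{\<Sigma>. is_arg_min (\<lambda>\<Sigma>. max_dist M \<Sigma> + ereal lam * max (enn2ereal (hausdorff1 \<Sigma>) - ereal l) 0)
                (\<lambda>\<Sigma>. compact \<Sigma> \<and> connected \<Sigma>) \<Sigma>}
       = {\<Sigma>. is_arg_min (max_dist M)
                (\<lambda>\<Sigma>. compact \<Sigma> \<and> connected \<Sigma> \<and> hausdorff1 \<Sigma> \<le> ennreal l) \<Sigma>}"
proof -
  define G where "G \<Sigma> = max_dist M \<Sigma> + ereal lam * max (enn2ereal (hausdorff1 \<Sigma>) - ereal l) 0"
    for \<Sigma>
  define feasible where "feasible \<Sigma> \<longleftrightarrow> compact \<Sigma> \<and> connected \<Sigma> \<and> hausdorff1 \<Sigma> \<le> ennreal l"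
    for \<Sigma> :: "(real ^ 'd) set"
  have G_feasible: "G \<Sigma> = max_dist M \<Sigma>" if "feasible \<Sigma>" for \<Sigma>
  proof -
    have "enn2ereal (hausdorff1 \<Sigma>) \<le> enn2ereal (ennreal l)"
      using that by (simp add: feasible_def less_eq_ennreal.rep_eq[symmetric])
    then have "enn2ereal (hausdorff1 \<Sigma>) \<le> ereal l"
      using \<open>l > 0\<close> by (simp add: enn2ereal_ennreal)
    then have "enn2ereal (hausdorff1 \<Sigma>) - ereal l \<le> 0"
      by (cases "enn2ereal (hausdorff1 \<Sigma>)") auto
    then show ?thesis by (simp add: G_def max_def)
  qed
  have improve: "\<exists>\<Sigma>'. feasible \<Sigma>' \<and> max_dist M \<Sigma>' < G \<Sigma>"
    if \<Sigma>: "compact \<Sigma>" "connected \<Sigma>" and long: "\<not> feasible \<Sigma>" for \<Sigma>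
  \<comment> \<open>No scaling makes an infinite length finite, so here the competitor is a single
    point: it has length 0 and finite \<open>max_dist\<close>, while the penalty of
    \<open>\<Sigma>\<close> is infinite.\<close>
  proof (cases "hausdorff1 \<Sigma> = \<infinity>")
    case True
    have "feasible {0}" by (simp add: feasible_def hausdorff1_subset_singleton)
    moreover have "G \<Sigma> = \<infinity>"
      using True max_dist_nonneg[OF \<open>M \<noteq> {}\<close>, of \<Sigma>] \<open>lam > 1\<close> by (simp add: G_def)
    moreover obtain r where "max_dist M {0} = ereal r"
      using max_dist_eq_ereal[OF assms(1,2), of "{0}"] by auto
    ultimately show ?thesis by (intro exI[of _ "{0}"]) simp
  next
    case False
    then obtain L where L: "hausdorff1 \<Sigma> = ennreal L" "L \<ge> 0"
      by (cases "hausdorff1 \<Sigma>") auto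
    have "L > l" using long \<Sigma> L(1) by (intro not_le_imp_less) (auto simp: feasible_def intro: ennreal_leI)
    \<comment> \<open>The empty set has length 0 and is thus feasible. Non-emptiness makes
      \<open>max_dist M \<Sigma>\<close> finite and supplies a centre for the shrinking.\<close>
    have "\<Sigma> \<noteq> {}"
      using long \<Sigma> hausdorff1_subset_singleton[of \<Sigma>] by (auto simp: feasible_def)
    obtain r where r: "max_dist M \<Sigma> = ereal r" "r \<ge> 0"
      using max_dist_eq_ereal[OF assms(1,2) \<open>\<Sigma> \<noteq> {}\<close>] .
    obtain \<Sigma>' where \<Sigma>': "feasible \<Sigma>'" "max_dist M \<Sigma>' \<le> max_dist M \<Sigma> + ereal (L - l)"
      using shrink_to_length[OF \<Sigma> \<open>\<Sigma> \<noteq> {}\<close> L(1) \<open>l > 0\<close>, of M] \<open>L > l\<close>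
      by (auto simp: feasible_def)
    have "1 * (L - l) < lam * (L - l)"
      using \<open>L > l\<close> \<open>lam > 1\<close> by (intro mult_strict_right_mono) auto
    moreover have "G \<Sigma> = ereal (r + lam * (L - l))"
      using \<open>L > l\<close> L r by (simp add: G_def enn2ereal_ennreal max_def)
    \<comment> \<open>The strict inequality survives the addition of
      \<open>max_dist M \<Sigma>\<close> because that is the real number \<open>r\<close>.\<close>
    ultimately have "max_dist M \<Sigma> + ereal (L - l) < G \<Sigma>" using r by simp
    with \<Sigma>' show ?thesis by (auto intro: le_less_trans)
  qed
  \<comment> \<open>By \<open>improve\<close>, a minimizer of \<open>G\<close> is feasible, and on
    feasible sets both objectives agree. Conversely, if an infeasible set had a smaller
    \<open>G\<close> than a constrained minimizer, the feasible set from \<open>improve\<close>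
    would have a still smaller \<open>max_dist\<close>, a contradiction.\<close>
  have "is_arg_min G (\<lambda>\<Sigma>. compact \<Sigma> \<and> connected \<Sigma>) \<Sigma> \<longleftrightarrow> is_arg_min (max_dist M) feasible \<Sigma>" for \<Sigma>
    unfolding is_arg_min_def using improve G_feasible
    by (smt (verit, best) feasible_def order_less_trans)
  then show ?thesis unfolding G_def[abs_def] feasible_def[abs_def] by blast
qed

end
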